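(* Let $\mathcal{Z}=\mathbb{R}^r$, $\mathcal{X}=\mathbb{R}^N$, and let $e\in C^1(\mathcal{X},\mathcal{Z})$ and $d\in C^1(\mathcal{Z},\mathcal{X})$ satisfy $e(d(\zeta))=\zeta$ for all $\zeta\in\mathcal{Z}$. Put $\tilde{\mathcal{X}}:=d(\mathcal{Z})$. Let a nonlinear port-Hamiltonian system on $\mathcal{Z}$ with data $(J,R,B,\mathcal{H})$ be given such that (i) $\mathcal{H}$ has a strict local minimum at $z_{\mathrm{e}}\in\mathcal{Z}$, i.e. there is a neighborhood $W\subset\mathcal{Z}$ of $z_{\mathrm{e}}$ with $\mathcal{H}(\zeta)>\mathcal{H}(z_{\mathrm{e}})$ for all $\zeta\in W\setminus\{z_{\mathrm{e}}\}$; and (ii) the input is zero, $u(t)=0$ for all $t\in\mathcal{T}$. Then $x_{\mathrm{e}}:=d(z_{\mathrm{e}})\in\tilde{\mathcal{X}}$ is a strict local minimum of $\bar{\mathcal{H}}=\mathcal{H}\circ e$ on $\tilde{\mathcal{X}}$, namely $\bar{\mathcal{H}}(\xi)>\bar{\mathcal{H}}(x_{\mathrm{e}})$ for all $\xi\in d(W)\setminus\{x_{\mathrm{e}}\}$, and $x_{\mathrm{e}}$ is a Lyapunov stable point, with Lyapunov function $\bar{\mathcal{H}}$, of the reconstructed port-Hamiltonian system on $\tilde{\mathcal{X}}$ (defined in the context).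
   Context: $\mathcal{T}=[0,t_{\mathrm{end}}]$ with $t_{\mathrm{end}}>0$; $u:\mathcal{T}\to\mathbb{R}^p$ is the input signal; $Dd(\zeta)\in\mathbb{R}^{N\times r}$ is the Jacobian of $d$ at $\zeta$; $\|\cdot\|$ is a norm on $\mathcal{X}$. A nonlinear port-Hamiltonian (pH) system on $\mathcal{Z}$ consists of a differentiable function $\mathcal{H}:\mathcal{Z}\to\mathbb{R}$ (the Hamiltonian) and continuous maps $J,R:\mathcal{Z}\to\mathbb{R}^{r\times r}$, $B:\mathcal{Z}\to\mathbb{R}^{r\times p}$ with $J(\zeta)=-J(\zeta)^{\top}$ and $R(\zeta)=R(\zeta)^{\top}\succeq 0$ for all $\zeta\in\mathcal{Z}$; it is the system $$\dot z(t)=\big(J(z(t))-R(z(t))\big)\nabla\mathcal{H}(z(t))+B(z(t))\,u(t),\quad z(0)=z_0,\qquad y(t)=B(z(t))^{\top}\nabla\mathcal{H}(z(t)).$$ The reconstructed pH system on $\tilde{\mathcal{X}}$ is $$\dot{\tilde x}(t)=\big(\bar J(\tilde x(t))-\bar R(\tilde x(t))\big)\nabla\bar{\mathcal{H}}(\tilde x(t))+\bar B(\tilde x(t))\,u(t),\quad \tilde x(0)=\tilde x_0=d(z_0),\qquad \bar y(t)=\bar B(\tilde x(t))^{\top}\nabla\bar{\mathcal{H}}(\tilde x(t)),$$ with trajectories $\tilde x(t)\in\tilde{\mathcal{X}}$, $\bar{\mathcal{H}}=\mathcal{H}\circ e$ (gradient taken in $\mathbb{R}^N$), and, for $\xi=d(\zeta)$,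 $\bar J(\xi)=Dd(\zeta)J(\zeta)Dd(\zeta)^{\top}$, $\bar R(\xi)=Dd(\zeta)R(\zeta)Dd(\zeta)^{\top}$, $\bar B(\xi)=Dd(\zeta)B(\zeta)$. Its trajectories are the reconstructions $\tilde x(t)=d(z(t))$ of solutions $z$ of the system on $\mathcal{Z}$. For zero input, a point $x_{\mathrm{e}}\in\tilde{\mathcal{X}}$ is an equilibrium point if the right-hand side of the differential equation vanishes at $x_{\mathrm{e}}$. An equilibrium point $x_{\mathrm{e}}$ is Lyapunov stable if for all $\varepsilon>0$ there is $\delta>0$ such that, for initial values $\tilde x_0\in\tilde{\mathcal{X}}$, $\|x_{\mathrm{e}}-\tilde x_0\|\le\delta$ implies $\|x_{\mathrm{e}}-\tilde x(t)\|\le\varepsilon$ for all $t\in\mathcal{T}$, where $\tilde x:\mathcal{T}\to\tilde{\mathcal{X}}$ is a solution with $\tilde x(0)=\tilde x_0$. A function $V$ is a Lyapunov function for $x_{\mathrm{e}}$ if, on a neighborhood of $x_{\mathrm{e}}$ in $\tilde{\mathcal{X}}$, $V$ has a strict minimum at $x_{\mathrm{e}}$ and $\frac{\mathrm{d}}{\mathrm{d}t}V(\tilde x(t))\le0$ along solutions in that neighborhood. Solutions are differentiable functions satisfying the equations for all $t\in\mathcal{T}$. *)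

theory Defs
  imports "HOL-Analysis.Analysis"
begin

definition is_norm :: "('a::real_vector \<Rightarrow> real) \<Rightarrow> bool" where
  "is_norm n \<longleftrightarrow>
     (\<forall>x. 0 \<le> n x) \<and> (\<forall>x. n x = 0 \<longleftrightarrow> x = 0) \<and>
     (\<forall>a x. n (a *\<^sub>R x) = \<bar>a\<bar> * n x) \<and> (\<forall>x y. n (x + y) \<le> n x + n y)"

definition C1 :: "(real^'m \<Rightarrow> real^'k) \<Rightarrow> bool" where
  "C1 f \<longleftrightarrow> f differentiable_on UNIV \<and> continuous_on UNIV (\<lambda>x. jacobian f (at x))"

definition grad :: "('a::real_inner \<Rightarrow> real) \<Rightarrow> 'a \<Rightarrow> 'a" where
  "grad f x = (THE D. GDERIV f x :> D)"

text \<open>\<open>strict_min_on_nbhd S W f x\<close>: \<open>W\<close> is a (not necessarily open) neighborhood of \<open>x\<close> in the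
  subspace \<open>S\<close>, and \<open>f\<close> restricted to \<open>W\<close> has a strict minimum at \<open>x\<close>.\<close>

definition strict_min_on_nbhd ::
  "'a::topological_space set \<Rightarrow> 'a set \<Rightarrow> ('a \<Rightarrow> real) \<Rightarrow> 'a \<Rightarrow> bool" where
  "strict_min_on_nbhd S W f x \<longleftrightarrow>
     W \<subseteq> S \<and> (\<exists>U. openin (top_of_set S) U \<and> x \<in> U \<and> U \<subseteq> W) \<and>
     (\<forall>w \<in> W - {x}. f w > f x)"

definition ph_data ::
  "(real^'m \<Rightarrow> real^'m^'m) \<Rightarrow> (real^'m \<Rightarrow> real^'m^'m) \<Rightarrow> (real^'m \<Rightarrow> real^'p^'m)
    \<Rightarrow> (real^'m \<Rightarrow> real) \<Rightarrow> bool" where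
  "ph_data J R B H \<longleftrightarrow>
     H differentiable_on UNIV \<and>
     continuous_on UNIV J \<and> continuous_on UNIV R \<and> continuous_on UNIV B \<and>
     (\<forall>z. J z = - transpose (J z)) \<and>
     (\<forall>z. R z = transpose (R z) \<and> (\<forall>v. 0 \<le> v \<bullet> (R z *v v)))"

definition ph_rhs ::
  "(real^'m \<Rightarrow> real^'m^'m) \<Rightarrow> (real^'m \<Rightarrow> real^'m^'m) \<Rightarrow> (real^'m \<Rightarrow> real^'p^'m)
    \<Rightarrow> (real^'m \<Rightarrow> real) \<Rightarrow> real^'m \<Rightarrow> real^'p \<Rightarrow> real^'m" where
  "ph_rhs J R B H x v = (J x - R x) *v grad H x + B x *v v"

text \<open>State \<open>x\<close> and output \<open>y\<close> solve, on \<open>[0, tend]\<close> and within the state space \<open>S\<close>, the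
  port-Hamiltonian system with input \<open>u\<close> and initial value \<open>x0\<close>; the derivative is one-sided at
  the two end points.\<close>

definition ph_solution ::
  "(real^'m) set \<Rightarrow> (real^'m \<Rightarrow> real^'m^'m) \<Rightarrow> (real^'m \<Rightarrow> real^'m^'m) \<Rightarrow> (real^'m \<Rightarrow> real^'p^'m)
    \<Rightarrow> (real^'m \<Rightarrow> real) \<Rightarrow> real \<Rightarrow> (real \<Rightarrow> real^'p) \<Rightarrow> real^'m
    \<Rightarrow> (real \<Rightarrow> real^'m) \<Rightarrow> (real \<Rightarrow> real^'p) \<Rightarrow> bool" where
  "ph_solution S J R B H tend u x0 x y \<longleftrightarrow>
     x 0 = x0 \<and>
     (\<forall>t \<in> {0..tend}. x t \<in> S \<and>
        (x has_vector_derivative ph_rhs J R B H (x t) (u t)) (at t within {0..tend}) \<and>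
        y t = transpose (B (x t)) *v grad H (x t))"

definition ph_equilibrium ::
  "(real^'m) set \<Rightarrow> (real^'m \<Rightarrow> real^'m^'m) \<Rightarrow> (real^'m \<Rightarrow> real^'m^'m) \<Rightarrow> (real^'m \<Rightarrow> real^'p^'m)
    \<Rightarrow> (real^'m \<Rightarrow> real) \<Rightarrow> real^'m \<Rightarrow> bool" where
  "ph_equilibrium S J R B H xe \<longleftrightarrow> xe \<in> S \<and> ph_rhs J R B H xe 0 = 0"

definition lyapunov_stable ::
  "(real^'m \<Rightarrow> real) \<Rightarrow> (real^'m) set \<Rightarrow> (real^'m \<Rightarrow> real^'m^'m) \<Rightarrow> (real^'m \<Rightarrow> real^'m^'m)
    \<Rightarrow> (real^'m \<Rightarrow> real^'p^'m) \<Rightarrow> (real^'m \<Rightarrow> real) \<Rightarrow> real \<Rightarrow> (real \<Rightarrow> real^'p)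
    \<Rightarrow> real^'m \<Rightarrow> bool" where
  "lyapunov_stable nrm S J R B H tend u xe \<longleftrightarrow>
     ph_equilibrium S J R B H xe \<and>
     (\<forall>\<epsilon>>0. \<exists>\<delta>>0. \<forall>x0 \<in> S. nrm (xe - x0) \<le> \<delta> \<longrightarrow>
        (\<forall>x y. ph_solution S J R B H tend u x0 x y \<longrightarrow>
           (\<forall>t \<in> {0..tend}. nrm (xe - x t) \<le> \<epsilon>)))"

definition lyapunov_function ::
  "(real^'m) set \<Rightarrow> (real^'m \<Rightarrow> real^'m^'m) \<Rightarrow> (real^'m \<Rightarrow> real^'m^'m) \<Rightarrow> (real^'m \<Rightarrow> real^'p^'m)
    \<Rightarrow> (real^'m \<Rightarrow> real) \<Rightarrow> real \<Rightarrow> (real \<Rightarrow> real^'p) \<Rightarrow> real^'m \<Rightarrow> (real^'m \<Rightarrow> real) \<Rightarrow> bool" where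
  "lyapunov_function S J R B H tend u xe V \<longleftrightarrow>
     (\<exists>U. strict_min_on_nbhd S U V xe \<and>
        (\<forall>x0 x y. ph_solution S J R B H tend u x0 x y \<longrightarrow>
           (\<forall>t \<in> {0..tend}. x t \<in> U \<longrightarrow>
              (\<exists>D\<le>0. ((\<lambda>s. V (x s)) has_real_derivative D) (at t within {0..tend})))))"

text \<open>Coefficients of the reconstructed system at \<open>\<xi> = d \<zeta>\<close>. They are only meaningful for
  \<open>\<xi> \<in> range d\<close> and injective \<open>d\<close>, where \<open>the_inv d \<xi>\<close> is the unique such \<open>\<zeta>\<close>.\<close>

definition rec_square ::
  "(real^'r \<Rightarrow> real^'n) \<Rightarrow> (real^'r \<Rightarrow> real^'r^'r) \<Rightarrow> real^'n \<Rightarrow> real^'n^'n" where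
  "rec_square d A \<xi> =
     (let \<zeta> = the_inv d \<xi>; D = jacobian d (at \<zeta>) in D ** A \<zeta> ** transpose D)"

definition rec_port ::
  "(real^'r \<Rightarrow> real^'n) \<Rightarrow> (real^'r \<Rightarrow> real^'p^'r) \<Rightarrow> real^'n \<Rightarrow> real^'p^'n" where
  "rec_port d B \<xi> = (let \<zeta> = the_inv d \<xi> in jacobian d (at \<zeta>) ** B \<zeta>)"

end

theory Submission
  imports Defs
begin

text \<open>
  The energy \<open>V = H \<circ> e\<close> is defined and differentiable on the whole of \<open>\<real>\<^sup>N\<close>, and the
  reconstructed coefficients inherit the port-Hamiltonian structure: a congruence
  \<open>A \<mapsto> D A D\<^sup>T\<close> preserves skew-symmetry (\<open>rec_square_skew\<close>) and positive semidefiniteness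
  (\<open>rec_square_psd\<close>). Hence, with zero input and \<open>g = grad V (x t)\<close>, the chain rule gives
  \<open>(V \<circ> x)' = g \<bullet> J g - g \<bullet> R g = - g \<bullet> R g \<le> 0\<close> along every solution
  (\<open>ph_dissipation\<close>). This works directly in \<open>\<real>\<^sup>N\<close>, so a solution on \<open>range d\<close> never has
  to be pulled back to the coordinates \<open>\<zeta>\<close>.

  Since \<open>e\<close> is a continuous left inverse of \<open>d\<close>, the map \<open>d\<close> is a homeomorphism onto its range
  and carries the strict minimum of \<open>H\<close> to one of \<open>V\<close> on \<open>range d\<close>
  (\<open>strict_min_on_range_section\<close>). The gradient of \<open>V\<close> vanishes at \<open>d ze\<close> because that of \<open>H\<close>
  vanishes at \<open>ze\<close>, so \<open>d ze\<close> is an equilibrium.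

  Stability is then Lyapunov's direct method (\<open>lyapunov_direct_method\<close>). Its compactness argument
  needs \<open>range d\<close> to be closed, which holds because the range is the fixed point set of
  \<open>d \<circ> e\<close> (\<open>closed_range_section\<close>).
\<close>

section \<open>Norms on a Euclidean space\<close>

lemma is_norm_zero: "is_norm n \<Longrightarrow> n 0 = 0"
  by (simp add: is_norm_def)

text \<open>A norm is a convex function, and a convex function on a finite-dimensional space is
  continuous.\<close>

lemma is_norm_continuous_on:
  fixes n :: "'a::euclidean_space \<Rightarrow> real"
  assumes "is_norm n"
  shows "continuous_on A n"
proof -
  have "convex_on UNIV n"
  proof (rule convex_onI)
    fix t :: real and x y :: 'a
    assume t: "0 < t" "t < 1"
    have tri: "n (a + b) \<le> n a + n b" and hom: "n (c *\<^sub>R a) = \<bar>c\<bar> * n a" for a b c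
      using assms by (auto simp: is_norm_def)
    show "n ((1 - t) *\<^sub>R x + t *\<^sub>R y) \<le> (1 - t) * n x + t * n y"
      using tri[of "(1 - t) *\<^sub>R x" "t *\<^sub>R y"] t by (simp add: hom)
  qed simp
  then show ?thesis
    using convex_on_continuous continuous_on_subset open_UNIV subset_UNIV by metis
qed

text \<open>The constant is the minimum over the Euclidean unit sphere, which is attained by compactness
  and extends to all vectors by homogeneity. The bound lets small \<open>n\<close>-balls fit into Euclidean
  neighborhoods.\<close>

lemma is_norm_lower_bound:
  fixes n :: "'a::euclidean_space \<Rightarrow> real"
  assumes "is_norm n"
  shows "\<exists>c>0. \<forall>x. c * norm x \<le> n x"
proof -
  have ne: "sphere (0::'a) 1 \<noteq> {}"
    by simp
  obtain x0 where x0: "x0 \<in> sphere 0 1" and min: "\<And>x. x \<in> sphere 0 1 \<Longrightarrow> n x0 \<le> n x"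
    using continuous_attains_inf[OF compact_sphere ne is_norm_continuous_on[OF assms]] by metis
  have "n x0 * norm x \<le> n x" for x
  proof (cases "x = 0")
    case False
    then have "n x0 \<le> n ((1 / norm x) *\<^sub>R x)"
      by (intro min) simp
    also have "\<dots> = n x / norm x"
      using assms by (simp add: is_norm_def)
    finally show ?thesis
      using False by (simp add: field_simps)
  qed (use assms in \<open>simp add: is_norm_def\<close>)
  moreover have "n x0 > 0"
    using assms x0 by (force simp: is_norm_def order_less_le)
  ultimately show ?thesis by blast
qed

section \<open>Lyapunov's direct method\<close>

text \<open>On a small \<open>nrm\<close>-sphere \<open>K\<close> around \<open>xe\<close> within \<open>S\<close> the function \<open>V\<close> has, by compactness, a
  lower bound \<open>m > V xe\<close>. A curve that starts so near to \<open>xe\<close> that \<open>V (x 0) < m\<close>, and along which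
  \<open>V\<close> never exceeds its initial value, cannot meet \<open>K\<close>, and by the intermediate value theorem it
  cannot leave the ball without meeting \<open>K\<close>. No differential equation is involved, and \<open>\<delta>\<close>
  depends neither on the curve nor on the time horizon.\<close>

lemma lyapunov_direct_method:
  fixes S :: "'a::euclidean_space set" and V :: "'a \<Rightarrow> real"
  assumes nrm: "is_norm nrm" and S: "closed S" and V: "continuous_on S V"
    and min: "strict_min_on_nbhd S U V xe" and eps: "\<epsilon> > 0"
  shows "\<exists>\<delta>>0. \<forall>x (T::real). continuous_on {0..T} x \<longrightarrow> x ` {0..T} \<subseteq> S \<longrightarrow>
           (\<forall>t\<in>{0..T}. V (x t) \<le> V (x 0)) \<longrightarrow> nrm (xe - x 0) \<le> \<delta> \<longrightarrow>
           (\<forall>t\<in>{0..T}. nrm (xe - x t) \<le> \<epsilon>)"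
proof -
  obtain O' where O': "open O'" "xe \<in> O'" "S \<inter> O' \<subseteq> U" and xeS: "xe \<in> S"
    and strict: "\<And>w. w \<in> U \<Longrightarrow> w \<noteq> xe \<Longrightarrow> V w > V xe"
    using min unfolding strict_min_on_nbhd_def openin_open by blast
  obtain c where c: "c > 0" "\<And>x. c * norm x \<le> nrm x"
    using is_norm_lower_bound[OF nrm] by blast
  obtain r where r: "r > 0" "ball xe r \<subseteq> O'"
    using O' open_contains_ball by blast
  have near: "dist xe x < b" if "nrm (xe - x) < c * b" for x b
    using order.strict_trans1[OF c(2)[of "xe - x"] that] c(1) by (simp add: dist_norm)
  \<comment> \<open>The bound \<open>\<rho> < c * r\<close> keeps the \<open>nrm\<close>-sphere of radius \<open>\<rho>\<close> inside the Euclidean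
    ball of radius \<open>r\<close>, where the minimum is known to be strict.\<close>
  define \<rho> where "\<rho> = min \<epsilon> (c * r / 2)"
  have rho: "\<rho> > 0" "\<rho> \<le> \<epsilon>" "\<rho> < c * r"
    using eps c(1) r(1) by (auto simp: \<rho>_def min_def field_simps)
  define K where "K = S \<inter> {x. nrm (xe - x) = \<rho>}"
  have cont: "continuous_on A (\<lambda>x. nrm (xe - x))" for A
    by (rule continuous_on_compose2[OF is_norm_continuous_on[OF nrm, of UNIV]])
       (auto intro!: continuous_intros)
  have "closed K"
    unfolding K_def by (intro closed_Int S closed_Collect_eq cont continuous_intros)
  moreover have "K \<subseteq> ball xe r"
    using near rho by (auto simp: K_def)
  ultimately have "compact K"
    using bounded_ball bounded_subset compact_eq_bounded_closed by blast
  have K_above: "V w > V xe" if "w \<in> K" for w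
  proof (rule strict)
    show "w \<in> U"
      using that \<open>K \<subseteq> ball xe r\<close> r O' by (auto simp: K_def)
    show "w \<noteq> xe"
      using that rho is_norm_zero[OF nrm] by (auto simp: K_def)
  qed
  \<comment> \<open>The sphere may miss \<open>S\<close>, for instance if \<open>xe\<close> is isolated in \<open>S\<close>; then any level
    above \<open>V xe\<close> serves.\<close>
  have "\<exists>m > V xe. \<forall>w\<in>K. m \<le> V w"
  proof (cases "K = {}")
    case True
    then show ?thesis by (auto intro: gt_ex)
  next
    case False
    have "continuous_on K V"
      using V by (rule continuous_on_subset) (auto simp: K_def)
    then obtain w where "w \<in> K" "\<forall>v\<in>K. V w \<le> V v"
      using continuous_attains_inf[OF \<open>compact K\<close> False] by blast
    then show ?thesis using K_above by blast
  qed
  then obtain m where m: "m > V xe" "\<And>w. w \<in> K \<Longrightarrow> m \<le> V w"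
    by blast
  obtain b where b: "b > 0" "\<And>x. x \<in> S \<Longrightarrow> dist x xe < b \<Longrightarrow> dist (V x) (V xe) < m - V xe"
    using V xeS m(1) unfolding continuous_on_iff by (metis diff_gt_0_iff_gt)
  define \<delta> where "\<delta> = min (\<rho> / 2) (c * b / 2)"
  have delta: "\<delta> > 0" "\<delta> < \<rho>" "\<delta> < c * b"
    using rho b(1) c(1) by (auto simp: \<delta>_def min_def field_simps)
  have "nrm (xe - x t) \<le> \<epsilon>"
    if x: "continuous_on {0..T} x" "x ` {0..T} \<subseteq> S" "\<forall>t\<in>{0..T}. V (x t) \<le> V (x 0)"
      and init: "nrm (xe - x 0) \<le> \<delta>" and t: "t \<in> {0..T}" for x and T t :: real
  proof (rule ccontr)
    assume "\<not> nrm (xe - x t) \<le> \<epsilon>"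
    then have "\<rho> \<le> nrm (xe - x t)" using rho by simp
    moreover have "continuous_on {0..t} (\<lambda>s. nrm (xe - x s))"
      by (rule continuous_on_compose2[OF cont[of UNIV] continuous_on_subset[OF x(1)]])
         (use t in auto)
    ultimately obtain s where s: "0 \<le> s" "s \<le> t" "nrm (xe - x s) = \<rho>"
      using IVT'[of "\<lambda>s. nrm (xe - x s)" 0 \<rho> t] init delta t by auto
    then have "m \<le> V (x s)"
      using x(2) t by (intro m(2)) (auto simp: K_def)
    moreover have "V (x s) \<le> V (x 0)"
      using x(3) s t by auto
    moreover have "V (x 0) < m"
    proof -
      have "dist (V (x 0)) (V xe) < m - V xe"
      proof (rule b(2))
        show "x 0 \<in> S" using x(2) t by auto
        show "dist (x 0) xe < b"
          using near[of "x 0" b] init delta(3) by (simp add: dist_commute)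
      qed
      then show ?thesis
        by (simp add: dist_real_def)
    qed
    ultimately show False by simp
  qed
  then show ?thesis using delta(1) by blast
qed

section \<open>Energy balance of port-Hamiltonian systems\<close>

text \<open>Every linear functional \<open>f'\<close> is the inner product with a vector, namely with the adjoint of
  \<open>f'\<close> applied to \<open>1\<close>; this makes the definite description in \<open>grad\<close> well defined.\<close>

lemma GDERIV_grad:
  fixes f :: "'a::euclidean_space \<Rightarrow> real"
  assumes "f differentiable (at x)"
  shows "GDERIV f x :> grad f x"
proof -
  obtain f' where f': "(f has_derivative f') (at x)"
    using assms by (auto simp: differentiable_def)
  have "f' = (\<lambda>h. h \<bullet> adjoint f' 1)"
    using adjoint_works[OF has_derivative_linear[OF f'], of _ 1] by auto
  then have g: "GDERIV f x :> adjoint f' 1"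
    using f' by (simp add: gderiv_def)
  have "D = adjoint f' 1" if "GDERIV f x :> D" for D
    using has_derivative_unique[OF g[unfolded gderiv_def] that[unfolded gderiv_def]]
    by (metis inner_commute vector_eq_rdot)
  with g have "\<exists>!D. GDERIV f x :> D"
    by blast
  then show ?thesis
    unfolding grad_def by (rule theI')
qed

lemma skew_quadratic_form_zero:
  fixes A :: "real^'n^'n"
  assumes "A = - transpose A"
  shows "v \<bullet> (A *v v) = 0"
proof -
  have "v \<bullet> (A *v v) = (transpose A *v v) \<bullet> v"
    by (simp add: dot_lmul_matrix)
  also have "transpose A = - A" using assms by (metis minus_minus)
  also have "(- A *v v) \<bullet> v = - (v \<bullet> (A *v v))"
    using matrix_vector_mult_diff_rdistrib[of 0 A v] by (simp add: inner_commute)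
  finally show ?thesis by simp
qed

text \<open>The power balance of a port-Hamiltonian system: the skew part \<open>J\<close> conserves energy, \<open>R\<close>
  dissipates it, and the port term vanishes with the input.\<close>

lemma ph_dissipation:
  fixes J R :: "real^'m \<Rightarrow> real^'m^'m" and B :: "real^'m \<Rightarrow> real^'p^'m"
  assumes sol: "ph_solution S J R B H tend u x0 x y"
    and H: "H differentiable_on UNIV"
    and J: "\<And>z. J z = - transpose (J z)"
    and R: "\<And>z v. 0 \<le> v \<bullet> (R z *v v)"
    and t: "t \<in> {0..tend}" and u: "u t = 0"
  shows "\<exists>D\<le>0. ((\<lambda>s. H (x s)) has_real_derivative D) (at t within {0..tend})"
proof -
  let ?g = "grad H (x t)"
  let ?D = "ph_rhs J R B H (x t) (u t) \<bullet> ?g"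
  have x': "(x has_vector_derivative ph_rhs J R B H (x t) (u t)) (at t within {0..tend})"
    using sol t by (simp add: ph_solution_def)
  have "(H has_derivative (\<lambda>h. h \<bullet> ?g)) (at (x t))"
    using GDERIV_grad[of H "x t"] H by (simp add: gderiv_def differentiable_on_def)
  from has_derivative_compose[OF x'[unfolded has_vector_derivative_def] this]
  have "((\<lambda>s. H (x s)) has_real_derivative ?D) (at t within {0..tend})"
    by (simp add: has_field_derivative_def mult_commute_abs)
  moreover have "?D = ?g \<bullet> (J (x t) *v ?g) - ?g \<bullet> (R (x t) *v ?g)"
    by (simp add: ph_rhs_def u matrix_vector_mult_diff_rdistrib inner_diff_right inner_diff_left inner_commute)
  then have "?D \<le> 0"
    using R skew_quadratic_form_zero[OF J] by simp
  ultimately show ?thesis by blast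
qed

lemma ph_energy_nonincreasing:
  fixes J R :: "real^'m \<Rightarrow> real^'m^'m" and B :: "real^'m \<Rightarrow> real^'p^'m"
  assumes sol: "ph_solution S J R B H tend u x0 x y"
    and "H differentiable_on UNIV"
    and "\<And>z. J z = - transpose (J z)"
    and "\<And>z v. 0 \<le> v \<bullet> (R z *v v)"
    and u: "\<And>t. t \<in> {0..tend} \<Longrightarrow> u t = 0"
    and t: "t \<in> {0..tend}"
  shows "H (x t) \<le> H (x 0)"
proof -
  let ?V = "\<lambda>s. H (x s)"
  have diss: "\<exists>D\<le>0. (?V has_real_derivative D) (at s within {0..tend})" if "s \<in> {0..tend}" for s
    using ph_dissipation[OF assms(1-4) that u[OF that]] .
  have "continuous_on {0..tend} ?V"
    unfolding continuous_on_eq_continuous_within using diss by (blast intro: DERIV_continuous)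
  then have "continuous_on {0..t} ?V"
    by (rule continuous_on_subset) (use t in auto)
  moreover have "\<exists>D. (?V has_real_derivative D) (at s) \<and> D \<le> 0" if "0 < s" "s < t" for s
    using diss[of s] that t at_within_interior[of s "{0..tend}"] by auto
  ultimately show ?thesis
    using DERIV_nonpos_imp_decreasing_open[of 0 t ?V] t by auto
qed

lemma grad_zero_at_local_min:
  fixes f :: "'a::euclidean_space \<Rightarrow> real"
  assumes "strict_min_on_nbhd UNIV W f x" and "f differentiable (at x)"
  shows "grad f x = 0"
proof -
  obtain U where U: "open U" "x \<in> U" "U \<subseteq> W" "\<forall>w\<in>W - {x}. f w > f x"
    using assms(1) by (auto simp: strict_min_on_nbhd_def)
  have "(f has_derivative (\<lambda>h. h \<bullet> grad f x)) (at x)"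
    using GDERIV_grad[OF assms(2)] by (simp add: gderiv_def)
  moreover have "\<forall>y\<in>U. f x \<le> f y"
    using U by (metis DiffI less_eq_real_def singletonD subsetD)
  ultimately have "(\<lambda>h. h \<bullet> grad f x) = (\<lambda>h. 0)"
    using differential_zero_maxmin[OF U(2,1)] by blast
  then show ?thesis by (metis inner_eq_zero_iff)
qed

section \<open>The reconstructed system\<close>

lemma rec_square_skew:
  assumes "\<And>z. J z = - transpose (J z)"
  shows "rec_square d J \<xi> = - transpose (rec_square d J \<xi>)"
proof -
  have neg: "X ** (- Y) = - (X ** Y)" "(- Y) ** Z = - (Y ** Z)"
    for X :: "real^'i^'j" and Y :: "real^'k^'i" and Z :: "real^'l^'k"
    by (simp_all add: vec_eq_iff matrix_matrix_mult_def sum_negf)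
  have "transpose (J z) = - J z" for z
    using assms by (metis minus_minus)
  then show ?thesis
    by (simp add: rec_square_def Let_def matrix_transpose_mul matrix_mul_assoc neg)
qed

lemma rec_square_psd:
  assumes "\<And>z v. 0 \<le> v \<bullet> (R z *v v)"
  shows "0 \<le> v \<bullet> (rec_square d R \<xi> *v v)"
proof -
  define D where "D = jacobian d (at (the_inv d \<xi>))"
  have "v \<bullet> (rec_square d R \<xi> *v v) = v \<bullet> (D *v (R (the_inv d \<xi>) *v (transpose D *v v)))"
    by (simp only: rec_square_def Let_def D_def matrix_vector_mul_assoc matrix_mul_assoc)
  also have "\<dots> = (transpose D *v v) \<bullet> (R (the_inv d \<xi>) *v (transpose D *v v))"
    by (simp add: dot_lmul_matrix)
  finally show ?thesis using assms by simp
qed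

text \<open>The image \<open>d ` U\<close> of an open set is relatively open because it equals
  \<open>range d \<inter> e -` U\<close>.\<close>

lemma strict_min_on_range_section:
  fixes H :: "'b::topological_space \<Rightarrow> real"
  assumes e: "continuous_on UNIV e" and ed: "\<And>\<zeta>. e (d \<zeta>) = \<zeta>"
    and "strict_min_on_nbhd UNIV W H z"
  shows "strict_min_on_nbhd (range d) (d ` W) (H \<circ> e) (d z)"
proof -
  obtain U where U: "open U" "z \<in> U" "U \<subseteq> W" and W: "\<forall>w\<in>W - {z}. H w > H z"
    using assms(3) by (auto simp: strict_min_on_nbhd_def)
  have "d ` U = range d \<inter> e -` U"
    using ed by force
  moreover have "open (e -` U)"
    using e U(1) by (simp add: open_vimage)
  ultimately have "openin (top_of_set (range d)) (d ` U)"
    by (auto simp: openin_open)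
  then show ?thesis
    using U W ed unfolding strict_min_on_nbhd_def by auto
qed

lemma closed_range_section:
  fixes d :: "'b::topological_space \<Rightarrow> 'a::t2_space"
  assumes "continuous_on UNIV e" "continuous_on UNIV d" "\<And>\<zeta>. e (d \<zeta>) = \<zeta>"
  shows "closed (range d)"
proof -
  have "range d = {x. d (e x) = x}"
    using assms(3) by (auto, metis rangeI)
  moreover have "closed {x. d (e x) = x}"
    by (intro closed_Collect_eq continuous_on_compose2[OF assms(2,1)] continuous_on_id) auto
  ultimately show ?thesis by simp
qed

section \<open>Stability of the reconstructed equilibrium\<close>

theorem mainTheorem4:
  fixes e :: "real^'n \<Rightarrow> real^'r" and d :: "real^'r \<Rightarrow> real^'n"
    and J R :: "real^'r \<Rightarrow> real^'r^'r" and B :: "real^'r \<Rightarrow> real^'p^'r"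
    and H :: "real^'r \<Rightarrow> real"
    and u :: "real \<Rightarrow> real^'p" and tend :: real
    and nrm :: "real^'n \<Rightarrow> real"
    and ze :: "real^'r" and W :: "(real^'r) set"
  assumes "is_norm nrm"
    and "tend > 0"
    and "C1 e" and "C1 d"
    and "\<And>\<zeta>. e (d \<zeta>) = \<zeta>"
    and "ph_data J R B H"
    and "strict_min_on_nbhd UNIV W H ze"
    and "\<And>t. t \<in> {0..tend} \<Longrightarrow> u t = 0"
  shows "strict_min_on_nbhd (range d) (d ` W) (H \<circ> e) (d ze)
    \<and> lyapunov_stable nrm (range d) (rec_square d J) (rec_square d R) (rec_port d B) (H \<circ> e)
        tend u (d ze)
    \<and> lyapunov_function (range d) (rec_square d J) (rec_square d R) (rec_port d B) (H \<circ> e)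
        tend u (d ze) (H \<circ> e)"
proof (intro conjI)
  let ?S = "range d" and ?J = "rec_square d J" and ?R = "rec_square d R"
    and ?B = "rec_port d B" and ?H = "H \<circ> e"
  have diff_e: "e differentiable (at x)" and diff_H: "H differentiable (at z)" for x z
    using assms(3,6) by (auto simp: C1_def ph_data_def differentiable_on_def)
  have cont: "continuous_on UNIV e" "continuous_on UNIV d"
    using assms(3,4) by (auto simp: C1_def differentiable_imp_continuous_on)
  have diff_V: "?H differentiable_on UNIV"
    by (auto simp: differentiable_on_def intro!: differentiable_chain_at diff_e diff_H)
  have J: "?J \<xi> = - transpose (?J \<xi>)" for \<xi>
    using assms(6) by (intro rec_square_skew) (simp add: ph_data_def)
  have R: "0 \<le> v \<bullet> (?R \<xi> *v v)" for \<xi> v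
    using assms(6) by (intro rec_square_psd) (simp add: ph_data_def)

  show min: "strict_min_on_nbhd ?S (d ` W) ?H (d ze)"
    by (rule strict_min_on_range_section[OF cont(1) assms(5,7)])

  have "\<exists>D\<le>0. ((\<lambda>s. ?H (x s)) has_real_derivative D) (at t within {0..tend})"
    if "ph_solution ?S ?J ?R ?B ?H tend u x0 x y" "t \<in> {0..tend}" for x0 x y t
    by (rule ph_dissipation[OF that(1) diff_V J R that(2) assms(8)[OF that(2)]])
  with min show "lyapunov_function ?S ?J ?R ?B ?H tend u (d ze) ?H"
    unfolding lyapunov_function_def by blast

  \<comment> \<open>The minimum of \<open>H \<circ> e\<close> at \<open>d ze\<close> is only relative to \<open>range d\<close>, so it does not by itself
    make the full gradient in \<open>\<real>\<^sup>N\<close> vanish. The chain rule through \<open>e\<close> does: the derivative of \<open>H\<close>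
    at \<open>e (d ze) = ze\<close> is already zero.\<close>
  have "((H \<circ> e) has_derivative (\<lambda>h. 0)) (at (d ze))"
  proof -
    have "(H has_derivative (\<lambda>h. h \<bullet> grad H ze)) (at (e (d ze)))"
      using GDERIV_grad[OF diff_H] assms(5) by (simp add: gderiv_def)
    then have "(H has_derivative (\<lambda>h. 0)) (at (e (d ze)))"
      using grad_zero_at_local_min[OF assms(7) diff_H] by simp
    moreover obtain e' where "(e has_derivative e') (at (d ze))"
      using diff_e by (auto simp: differentiable_def)
    ultimately show ?thesis
      using diff_chain_at[of e e' "d ze" H "\<lambda>h. 0"] by (simp add: o_def)
  qed
  moreover have "(?H has_derivative (\<lambda>h. h \<bullet> grad ?H (d ze))) (at (d ze))"
    using GDERIV_grad diff_V by (auto simp: gderiv_def differentiable_on_def)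
  ultimately have "(\<lambda>h. h \<bullet> grad ?H (d ze)) = (\<lambda>h. 0)"
    by (metis has_derivative_unique)
  then have "grad ?H (d ze) = 0"
    by (metis inner_eq_zero_iff)
  then have equi: "ph_equilibrium ?S ?J ?R ?B ?H (d ze)"
    by (simp add: ph_equilibrium_def ph_rhs_def)

  show "lyapunov_stable nrm ?S ?J ?R ?B ?H tend u (d ze)"
    unfolding lyapunov_stable_def
  proof (intro conjI equi allI impI)
    fix \<epsilon> :: real
    assume "\<epsilon> > 0"
    from lyapunov_direct_method[OF assms(1) closed_range_section[OF cont assms(5)]
        continuous_on_subset[OF differentiable_imp_continuous_on[OF diff_V] subset_UNIV] min this]
    obtain \<delta> where "\<delta> > 0" and stay:
      "\<forall>x (T::real). continuous_on {0..T} x \<longrightarrow> x ` {0..T} \<subseteq> ?S \<longrightarrow>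
         (\<forall>t\<in>{0..T}. ?H (x t) \<le> ?H (x 0)) \<longrightarrow> nrm (d ze - x 0) \<le> \<delta> \<longrightarrow>
         (\<forall>t\<in>{0..T}. nrm (d ze - x t) \<le> \<epsilon>)"
      by (elim exE conjE)
    have "nrm (d ze - x t) \<le> \<epsilon>"
      if init: "nrm (d ze - x0) \<le> \<delta>"
        and sol: "ph_solution ?S ?J ?R ?B ?H tend u x0 x y" and t: "t \<in> {0..tend}" for x0 x y t
    proof (rule stay[rule_format, OF _ _ _ _ t])
      show "continuous_on {0..tend} x"
        unfolding continuous_on_eq_continuous_within
        using sol by (auto simp: ph_solution_def intro: has_vector_derivative_continuous)
      show "x ` {0..tend} \<subseteq> ?S" and "nrm (d ze - x 0) \<le> \<delta>"
        using sol init by (auto simp: ph_solution_def)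
      show "?H (x s) \<le> ?H (x 0)" if "s \<in> {0..tend}" for s
        by (rule ph_energy_nonincreasing[OF sol diff_V J R assms(8) that])
    qed
    with \<open>\<delta> > 0\<close> show "\<exists>\<delta>>0. \<forall>x0\<in>?S. nrm (d ze - x0) \<le> \<delta> \<longrightarrow>
        (\<forall>x y. ph_solution ?S ?J ?R ?B ?H tend u x0 x y \<longrightarrow>
          (\<forall>t\<in>{0..tend}. nrm (d ze - x t) \<le> \<epsilon>))"
      by blast
  qed
qed

end
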